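(* If a real $6$-dimensional nilpotent Lie algebra $\mathfrak g$ has an open mutually respectful decomposition $(H,V)$, then either $\mathfrak g\cong\mathfrak h_3\oplus\mathfrak h_3$ or $\mathfrak g\cong\mathbb R\oplus\mathfrak h_5$.
   Context: All Lie algebras are real and finite dimensional. For vector subspaces $A,B$ of a Lie algebra, $[A,B]$ denotes the linear span of all brackets $[a,b]$, $a\in A$, $b\in B$. An ordered pair $(H,V)$ of complementary vector subspaces of a Lie algebra $\mathfrak g$ (so $\mathfrak g=H\oplus V$ as a vector space) is a respectful decomposition of $\mathfrak g$ if $[V,H]\subseteq H$ (one says $V$ respects $H$). It is open if neither $H$ nor $V$ is a Lie subalgebra of $\mathfrak g$. It is mutually respectful if $V$ respects $H$ and $H$ respects $V$, i.e. $[V,H]\subseteq H$ and $[H,V]\subseteq V$. The Heisenberg algebra $\mathfrak h_{2n+1}$ has basis $\{x_i,y_i,z: i=1,\dots,n\}$ and relations $[x_i,y_i]=z$ for $i=1,\dots,n$ (all other brackets of basis elements being zero). $\mathbb R$ denotes the one-dimensional Abelian Lie algebra, and $\oplus$ between Lie algebras is the direct sum of Lie algebras. *)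

theory Defs
  imports "HOL-Analysis.Analysis"
begin

section \<open>Real Lie algebras\<close>

text \<open>
  A Lie algebra is a bracket on a whole type of class \<open>real_vector\<close>. The dimension is
  \<^term>\<open>dim (UNIV :: 'a::real_vector set)\<close>; since \<^const>\<open>dim\<close> is \<open>0\<close> on infinite-dimensional
  spaces, a positive value of it entails finite-dimensionality.
\<close>

locale lie_algebra =
  fixes br :: "'a::real_vector \<Rightarrow> 'a \<Rightarrow> 'a"
  assumes bilinear_br: "bilinear br"
    and br_self: "br x x = 0"
    and jacobi: "br x (br y z) + br y (br z x) + br z (br x y) = 0"

definition bracket_span :: "('a::real_vector \<Rightarrow> 'a \<Rightarrow> 'a) \<Rightarrow> 'a set \<Rightarrow> 'a set \<Rightarrow> 'a set" where
  "bracket_span br A B = span {br a b | a b. a \<in> A \<and> b \<in> B}"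

definition lie_subalgebra :: "('a::real_vector \<Rightarrow> 'a \<Rightarrow> 'a) \<Rightarrow> 'a set \<Rightarrow> bool" where
  "lie_subalgebra br S \<longleftrightarrow> subspace S \<and> bracket_span br S S \<subseteq> S"

primrec lower_central_series :: "('a::real_vector \<Rightarrow> 'a \<Rightarrow> 'a) \<Rightarrow> nat \<Rightarrow> 'a set" where
  "lower_central_series br 0 = UNIV"
| "lower_central_series br (Suc k) = bracket_span br UNIV (lower_central_series br k)"

definition nilpotent_lie :: "('a::real_vector \<Rightarrow> 'a \<Rightarrow> 'a) \<Rightarrow> bool" where
  "nilpotent_lie br \<longleftrightarrow> (\<exists>k. lower_central_series br k = {0})"

definition lie_isomorphic ::
  "('a::real_vector \<Rightarrow> 'a \<Rightarrow> 'a) \<Rightarrow> ('b::real_vector \<Rightarrow> 'b \<Rightarrow> 'b) \<Rightarrow> bool" where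
  "lie_isomorphic br br' \<longleftrightarrow>
     (\<exists>f. linear f \<and> bij f \<and> (\<forall>x y. f (br x y) = br' (f x) (f y)))"


section \<open>Respectful decompositions\<close>

definition complementary :: "'a::real_vector set \<Rightarrow> 'a set \<Rightarrow> bool" where
  "complementary H V \<longleftrightarrow>
     subspace H \<and> subspace V \<and> H \<inter> V = {0} \<and> {h + v | h v. h \<in> H \<and> v \<in> V} = UNIV"

definition lie_respects :: "('a::real_vector \<Rightarrow> 'a \<Rightarrow> 'a) \<Rightarrow> 'a set \<Rightarrow> 'a set \<Rightarrow> bool" where
  "lie_respects br V H \<longleftrightarrow> bracket_span br V H \<subseteq> H"

definition respectful_decomposition ::
  "('a::real_vector \<Rightarrow> 'a \<Rightarrow> 'a) \<Rightarrow> 'a set \<Rightarrow> 'a set \<Rightarrow> bool" where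
  "respectful_decomposition br H V \<longleftrightarrow> complementary H V \<and> lie_respects br V H"

definition open_decomposition ::
  "('a::real_vector \<Rightarrow> 'a \<Rightarrow> 'a) \<Rightarrow> 'a set \<Rightarrow> 'a set \<Rightarrow> bool" where
  "open_decomposition br H V \<longleftrightarrow> \<not> lie_subalgebra br H \<and> \<not> lie_subalgebra br V"

definition mutually_respectful_decomposition ::
  "('a::real_vector \<Rightarrow> 'a \<Rightarrow> 'a) \<Rightarrow> 'a set \<Rightarrow> 'a set \<Rightarrow> bool" where
  "mutually_respectful_decomposition br H V \<longleftrightarrow>
     respectful_decomposition br H V \<and> lie_respects br H V"


section \<open>Direct sums, the line, and the Heisenberg algebras\<close>

definition direct_sum_br ::
  "('a::real_vector \<Rightarrow> 'a \<Rightarrow> 'a) \<Rightarrow> ('b::real_vector \<Rightarrow> 'b \<Rightarrow> 'b) \<Rightarrow> 'a \<times> 'b \<Rightarrow> 'a \<times> 'b \<Rightarrow> 'a \<times> 'b" where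
  "direct_sum_br br br' p q = (br (fst p) (fst q), br' (snd p) (snd q))"

definition line_br :: "real \<Rightarrow> real \<Rightarrow> real" where
  "line_br x y = 0"

text \<open>
  The Heisenberg algebra of dimension \<open>2 n + 1\<close>, with \<open>n = CARD('n)\<close>: the triple
  \<open>(a, b, c)\<close> stands for the element with coordinates \<open>a\<close> along the \<open>x\<^sub>i\<close>, \<open>b\<close> along the \<open>y\<^sub>i\<close>
  and \<open>c\<close> along \<open>z\<close>, and \<open>heis_br\<close> is the alternating bilinear extension of the relations
  \<open>[x\<^sub>i, y\<^sub>i] = z\<close>; see \<open>heis_basis_relations\<close> and \<open>heis_basis\<close> below.
\<close>

type_synonym 'n heis = "(real ^ 'n) \<times> (real ^ 'n) \<times> real"

definition heis_br :: "'n::finite heis \<Rightarrow> 'n heis \<Rightarrow> 'n heis" where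
  "heis_br p q = (case p of (a, b, c) \<Rightarrow> case q of (a', b', c') \<Rightarrow>
     (0, 0, \<Sum>i\<in>UNIV. a $ i * b' $ i - b $ i * a' $ i))"

definition heis_x :: "'n::finite \<Rightarrow> 'n heis" where "heis_x i = (axis i 1, 0, 0)"
definition heis_y :: "'n::finite \<Rightarrow> 'n heis" where "heis_y i = (0, axis i 1, 0)"
definition heis_z :: "'n::finite heis" where "heis_z = (0, 0, 1)"

lemma heis_basis_relations:
  "heis_br (heis_x i) (heis_y j) = (if i = j then heis_z else 0)"
  "heis_br (heis_x i) (heis_x j) = 0"
  "heis_br (heis_y i) (heis_y j) = 0"
  "heis_br (heis_x i) heis_z = 0"
  "heis_br (heis_y i) heis_z = 0"
  by (auto simp: heis_br_def heis_x_def heis_y_def heis_z_def axis_def zero_prod_def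
      if_distrib if_distribR cong: if_cong)

lemma heis_basis:
  fixes p :: "'n::finite heis"
  shows "\<exists>!(a, b, c). p = (\<Sum>i\<in>UNIV. (a $ i) *\<^sub>R heis_x i) + (\<Sum>i\<in>UNIV. (b $ i) *\<^sub>R heis_y i)
           + c *\<^sub>R heis_z"
proof -
  have sm: "(\<Sum>i\<in>UNIV. (f i, g i, h i)) = (sum f UNIV, sum g UNIV, sum h UNIV)"
    for f g :: "'n \<Rightarrow> real ^ 'n" and h :: "'n \<Rightarrow> real"
    by (simp add: prod_eq_iff fst_sum snd_sum)
  have ax: "(\<Sum>i\<in>UNIV. (a $ i) *\<^sub>R axis i 1) = a" for a :: "real ^ 'n"
    using basis_expansion[of a] by (simp add: scalar_mult_eq_scaleR)
  have "(\<Sum>i\<in>UNIV. (a $ i) *\<^sub>R heis_x i) + (\<Sum>i\<in>UNIV. (b $ i) *\<^sub>R heis_y i)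
           + c *\<^sub>R heis_z = (a, b, c)" for a b :: "real ^ 'n" and c
    by (simp add: heis_x_def heis_y_def heis_z_def sm ax)
  then show ?thesis by (cases p) auto
qed

lemma lie_algebra_heis: "lie_algebra (heis_br :: 'n::finite heis \<Rightarrow> _)"
  by unfold_locales
    (auto simp: heis_br_def bilinear_def linear_iff zero_prod_def algebra_simps
      sum.distrib sum_subtractf sum_distrib_left split: prod.splits)

lemma lie_algebra_line: "lie_algebra line_br"
  by unfold_locales (auto simp: line_br_def bilinear_def linear_iff)

lemma lie_algebra_direct_sum:
  assumes "lie_algebra br" "lie_algebra br'"
  shows "lie_algebra (direct_sum_br br br')"
proof -
  interpret A: lie_algebra br by fact
  interpret B: lie_algebra br' by fact
  show ?thesis
    using A.bilinear_br B.bilinear_br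
    by unfold_locales
      (auto simp: direct_sum_br_def bilinear_def linear_iff zero_prod_def
        A.br_self B.br_self A.jacobi B.jacobi)
qed

end

theory Submission
  imports Defs
begin

text \<open>
  Mutual respect gives \<open>[H, V] \<subseteq> H \<inter> V = 0\<close>. Choose \<open>h\<^sub>1, h\<^sub>2 \<in> H\<close> with \<open>[h\<^sub>1, h\<^sub>2] \<notin> H\<close> and
  \<open>v\<^sub>1, v\<^sub>2 \<in> V\<close> with \<open>[v\<^sub>1, v\<^sub>2] \<notin> V\<close>. By the Jacobi identity \<open>[h\<^sub>1, h\<^sub>2]\<close> commutes with \<open>V\<close>, so its
  nonzero \<open>V\<close>-component \<open>d\<close> is central; likewise the nonzero \<open>H\<close>-component \<open>c\<close> of \<open>[v\<^sub>1, v\<^sub>2]\<close>.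
  Bracketing a linear relation with the \<open>h\<^sub>i\<close> and \<open>v\<^sub>i\<close> shows that \<open>h\<^sub>1, h\<^sub>2, c, v\<^sub>1, v\<^sub>2, d\<close> are
  independent, hence a basis. Nilpotency forbids an eigenvector of \<open>ad x\<close> with nonzero eigenvalue,
  which forces \<open>[h\<^sub>1, h\<^sub>2]\<close> and \<open>[v\<^sub>1, v\<^sub>2]\<close> into the span of \<open>c, d\<close>. If these two brackets are
  independent, the algebra is \<open>\<hh>\<^sub>3 \<oplus> \<hh>\<^sub>3\<close>; if they are proportional, it is \<open>\<real> \<oplus> \<hh>\<^sub>5\<close>.
\<close>

text \<open>The type \<open>'a\<close> is a bare \<open>real_vector\<close>, so its dimension is
  accessible only through bases: a vector outside the span of the image of \<open>Basis\<close>
  would give an independent set larger than the basis \<open>T\<close>.\<close>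

lemma linear_inj_imp_surj_dim_eq:
  fixes g :: "'b::euclidean_space \<Rightarrow> 'a::real_vector"
  assumes g: "linear g" "inj g" and dim: "dim (UNIV :: 'a set) = DIM('b)"
  shows "surj g"
proof -
  let ?S = "g ` Basis"
  obtain T :: "'a set" where T: "independent T" "UNIV \<subseteq> span T" "card T = DIM('b)"
    using basis_exists[of "UNIV :: 'a set"] dim by auto
  \<comment> \<open>An infinite set has \<open>card\<close> 0, whereas \<open>DIM('b)\<close> is
    positive.\<close>
  then have fin: "finite T"
    by (intro card_ge_0_finite) simp
  have indS: "independent ?S"
    using independent_Basis g
    by (intro linear_independent_injective_image) (simp_all add: inj_on_subset[OF g(2)])
  have cardS: "card ?S = DIM('b)"
    by (intro card_image inj_on_subset[OF g(2)]) simp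
  have "x \<in> span ?S" for x
  proof (rule ccontr)
    assume x: "x \<notin> span ?S"
    then have "independent (insert x ?S)"
      by (rule independent_insertI[OF _ indS])
    then have "card (insert x ?S) \<le> card T"
      using independent_span_bound[OF fin, of "insert x ?S"] T(2) by (simp add: subset_iff)
    moreover have "card (insert x ?S) = Suc (card ?S)"
      using x by (intro card_insert_disjoint) (auto intro: span_base)
    ultimately show False
      unfolding cardS T(3) by linarith
  qed
  moreover have "span ?S = range g"
    using linear_span_image[OF g(1), of Basis] by simp
  ultimately show ?thesis
    by blast
qed

text \<open>Maps are easiest to write from the model algebra, where coordinates are explicit; this
  turns them around.\<close>

lemma lie_isomorphicI_inv:
  fixes br :: "'a::real_vector \<Rightarrow> 'a \<Rightarrow> 'a" and br' :: "'b::real_vector \<Rightarrow> 'b \<Rightarrow> 'b"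
  assumes g: "linear g" "bij g" and hom: "\<And>p q. g (br' p q) = br (g p) (g q)"
  shows "lie_isomorphic br br'"
proof -
  have gi: "g (inv g x) = x" "inv g (g p) = p" for x p
    using g(2) by (auto simp: bij_def surj_f_inv_f)
  have "linear (inv g)"
    by (rule linearI) (metis gi linear_add[OF g(1)] linear_scale[OF g(1)])+
  moreover have "inv g (br x y) = br' (inv g x) (inv g y)" for x y
    by (metis gi hom)
  ultimately show ?thesis
    unfolding lie_isomorphic_def using bij_imp_bij_inv[OF g(2)] by blast
qed

lemma not_lie_subalgebraE:
  assumes "\<not> lie_subalgebra br S" "subspace S"
  obtains x y where "x \<in> S" "y \<in> S" "br x y \<notin> S"
proof -
  have "\<not> {br a b |a b. a \<in> S \<and> b \<in> S} \<subseteq> S"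
    using assms span_minimal unfolding lie_subalgebra_def bracket_span_def by blast
  then show ?thesis
    using that by blast
qed

lemma lie_respectsD:
  "lie_respects br V H \<Longrightarrow> v \<in> V \<Longrightarrow> h \<in> H \<Longrightarrow> br v h \<in> H"
  unfolding lie_respects_def bracket_span_def by (auto intro!: span_base)

section \<open>Centralizers and eigenvectors of brackets\<close>

context lie_algebra
begin

lemmas br_simps =
  bilinear_ladd[OF bilinear_br] bilinear_radd[OF bilinear_br]
  bilinear_lmul[OF bilinear_br] bilinear_rmul[OF bilinear_br]
  bilinear_lzero[OF bilinear_br] bilinear_rzero[OF bilinear_br]
  bilinear_lsub[OF bilinear_br] bilinear_rsub[OF bilinear_br] br_self

lemma br_anticomm: "br x y = - br y x"
proof -
  have "br x x + br y x + (br x y + br y y) = 0"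
    using br_self[of "x + y"]
    unfolding bilinear_ladd[OF bilinear_br] bilinear_radd[OF bilinear_br] .
  then show ?thesis
    by (simp add: br_self eq_neg_iff_add_eq_0 add.commute)
qed

lemma br_commute_zero: "br x y = 0 \<Longrightarrow> br y x = 0"
  using br_anticomm[of y x] by simp

text \<open>By the Jacobi identity the centralizer of \<open>x\<close> is closed under
  brackets.\<close>

lemma br_commute_br:
  assumes "br x y = 0" "br x z = 0"
  shows "br x (br y z) = 0"
  using jacobi[of x y z] assms br_commute_zero by (simp add: br_simps)

text \<open>If \<open>t\<close> were nonzero, \<open>w\<close> would be the bracket of a multiple of
  \<open>x\<close> with \<open>w\<close> itself, and so would lie in every term of the lower central
  series.\<close>

lemma br_eigenvalue_zero:
  assumes "nilpotent_lie br" "br x w = t *\<^sub>R w" "w \<noteq> 0"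
  shows "t = 0"
proof (rule ccontr)
  assume t: "t \<noteq> 0"
  have "w \<in> lower_central_series br k" for k
  proof (induction k)
    case (Suc k)
    have "w = br ((1 / t) *\<^sub>R x) w"
      using t assms(2) by (simp add: br_simps)
    with Suc show ?case
      by (auto simp: bracket_span_def intro!: span_base)
  qed simp
  then show False
    using assms(1,3) unfolding nilpotent_lie_def by blast
qed

text \<open>The situation is recorded without \<open>H\<close> and \<open>V\<close>, so that the
  pairs can be swapped or rescaled and \<open>c\<close>, \<open>d\<close> replaced by another basis
  of their plane.\<close>

definition commuting_pairs :: "'a \<Rightarrow> 'a \<Rightarrow> 'a \<Rightarrow> 'a \<Rightarrow> 'a \<Rightarrow> 'a \<Rightarrow> bool" where
  "commuting_pairs h1 h2 v1 v2 c d \<longleftrightarrow>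
     br h1 v1 = 0 \<and> br h1 v2 = 0 \<and> br h2 v1 = 0 \<and> br h2 v2 = 0 \<and>
     br h1 h2 \<noteq> 0 \<and> br v1 v2 \<noteq> 0 \<and>
     (\<forall>x \<in> {h1, h2, v1, v2}. br x c = 0 \<and> br x d = 0) \<and>
     (\<forall>s t. s *\<^sub>R c + t *\<^sub>R d = 0 \<longrightarrow> s = 0 \<and> t = 0)"

lemma commuting_pairs_independent:
  assumes P: "commuting_pairs h1 h2 v1 v2 c d"
    and zero: "x *\<^sub>R h1 + y *\<^sub>R h2 + z *\<^sub>R c + (x' *\<^sub>R v1 + y' *\<^sub>R v2 + z' *\<^sub>R d) = 0"
      (is "?u = 0")
  shows "x = 0 \<and> y = 0 \<and> z = 0 \<and> x' = 0 \<and> y' = 0 \<and> z' = 0"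
proof -
  have vh: "br v1 h1 = 0" "br v2 h1 = 0" "br v1 h2 = 0" "br v2 h2 = 0"
    using P br_commute_zero unfolding commuting_pairs_def by blast+
  \<comment> \<open>Each of the four vectors commutes with all six except its partner, so bracketing
    with it isolates the partner's coefficient.\<close>
  have "br h1 ?u = y *\<^sub>R br h1 h2" "br h2 ?u = x *\<^sub>R br h2 h1"
       "br v1 ?u = y' *\<^sub>R br v1 v2" "br v2 ?u = x' *\<^sub>R br v2 v1"
    using P vh unfolding commuting_pairs_def by (simp_all add: br_simps)
  then have "y *\<^sub>R br h1 h2 = 0" "x *\<^sub>R br h2 h1 = 0"
       "y' *\<^sub>R br v1 v2 = 0" "x' *\<^sub>R br v2 v1 = 0"
    unfolding zero by (simp_all add: br_simps)
  moreover have "br h1 h2 \<noteq> 0" "br h2 h1 \<noteq> 0" "br v1 v2 \<noteq> 0" "br v2 v1 \<noteq> 0"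
    using P br_commute_zero unfolding commuting_pairs_def by blast+
  ultimately have *: "x = 0" "y = 0" "x' = 0" "y' = 0"
    by simp_all
  then show ?thesis
    using P zero unfolding commuting_pairs_def by simp
qed

text \<open>For general \<open>c\<close> and \<open>d\<close> this only provides coordinates; it
  respects brackets once \<open>c\<close> and \<open>d\<close> are the brackets of the two
  pairs.\<close>

definition pairs_map :: "'a \<Rightarrow> 'a \<Rightarrow> 'a \<Rightarrow> 'a \<Rightarrow> 'a \<Rightarrow> 'a \<Rightarrow> 1 heis \<times> 1 heis \<Rightarrow> 'a" where
  "pairs_map h1 h2 v1 v2 c d = (\<lambda>((a, b, r), (a', b', r')).
     (a $ 1) *\<^sub>R h1 + (b $ 1) *\<^sub>R h2 + r *\<^sub>R c + ((a' $ 1) *\<^sub>R v1 + (b' $ 1) *\<^sub>R v2 + r' *\<^sub>R d))"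

lemma linear_pairs_map: "linear (pairs_map h1 h2 v1 v2 c d)"
  by (rule linearI) (auto simp: pairs_map_def algebra_simps)

lemma bij_pairs_map:
  assumes P: "commuting_pairs h1 h2 v1 v2 c d" and dim: "dim (UNIV :: 'a set) = 6"
  shows "bij (pairs_map h1 h2 v1 v2 c d)"
proof -
  let ?g = "pairs_map h1 h2 v1 v2 c d"
  have "p = 0" if "?g p = 0" for p
    using commuting_pairs_independent[OF P] that
    by (auto simp: pairs_map_def vec_eq_iff zero_prod_def split: prod.splits)
  then have inj: "inj ?g"
    using linear_injective_0[OF linear_pairs_map] by blast
  then have "surj ?g"
    by (rule linear_inj_imp_surj_dim_eq[OF linear_pairs_map]) (simp add: dim)
  with inj show ?thesis
    by (simp add: bij_def)
qed

lemma commuting_pairs_span: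
  assumes "commuting_pairs h1 h2 v1 v2 c d" and "dim (UNIV :: 'a set) = 6"
  obtains x y z x' y' z'
  where "u = x *\<^sub>R h1 + y *\<^sub>R h2 + z *\<^sub>R c + (x' *\<^sub>R v1 + y' *\<^sub>R v2 + z' *\<^sub>R d)"
proof -
  obtain p where "u = pairs_map h1 h2 v1 v2 c d p"
    using bij_pairs_map[OF assms] by (metis bij_pointE)
  then show ?thesis
    using that by (auto simp: pairs_map_def split: prod.splits)
qed

lemma br_in_center_span:
  assumes P: "commuting_pairs h1 h2 v1 v2 c d" and dim: "dim (UNIV :: 'a set) = 6"
    and nil: "nilpotent_lie br"
  obtains s t where "br h1 h2 = s *\<^sub>R c + t *\<^sub>R d"
proof -
  let ?w = "br h1 h2"
  obtain x y z x' y' z'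
    where w: "?w = x *\<^sub>R h1 + y *\<^sub>R h2 + z *\<^sub>R c + (x' *\<^sub>R v1 + y' *\<^sub>R v2 + z' *\<^sub>R d)" (is "_ = ?u")
    using commuting_pairs_span[OF P dim] .
  have vh: "br v1 h1 = 0" "br v2 h1 = 0" "br v1 h2 = 0" "br v2 h2 = 0"
    using P br_commute_zero unfolding commuting_pairs_def by blast+
  have u: "br h1 ?u = y *\<^sub>R ?w" "br h2 ?u = x *\<^sub>R br h2 h1"
       "br v1 ?u = y' *\<^sub>R br v1 v2" "br v2 ?u = x' *\<^sub>R br v2 v1"
    using P vh unfolding commuting_pairs_def by (simp_all add: br_simps)
  \<comment> \<open>So \<open>?w\<close> is an eigenvector of ad \<open>h1\<close> and of ad
    \<open>h2\<close>, with eigenvalues \<open>y\<close> and \<open>- x\<close>. The other two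
    coefficients vanish because \<open>v1\<close> and \<open>v2\<close> commute with
    \<open>h1\<close> and \<open>h2\<close>, hence with \<open>?w\<close>.\<close>
  have "br h1 ?w = y *\<^sub>R ?w" "br h2 ?w = (- x) *\<^sub>R ?w"
    using u(1,2) br_anticomm[of h2 h1] by (simp_all flip: w)
  then have "y = 0" "x = 0"
    using br_eigenvalue_zero[OF nil] P unfolding commuting_pairs_def by fastforce+
  moreover have "y' *\<^sub>R br v1 v2 = 0" "x' *\<^sub>R br v2 v1 = 0"
    using u(3,4) br_commute_br vh by (metis w)+
  then have "y' = 0" "x' = 0"
    using P br_commute_zero[of v2 v1] unfolding commuting_pairs_def by auto
  ultimately show ?thesis
    using that[of z z'] w by simp
qed

section \<open>Isomorphisms with the two models\<close>

lemma lie_isomorphic_heis_heis: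
  assumes P: "commuting_pairs h1 h2 v1 v2 (br h1 h2) (br v1 v2)"
    and dim: "dim (UNIV :: 'a set) = 6"
  shows "lie_isomorphic br (direct_sum_br (heis_br :: 1 heis \<Rightarrow> 1 heis \<Rightarrow> 1 heis)
           (heis_br :: 1 heis \<Rightarrow> 1 heis \<Rightarrow> 1 heis))"
proof (rule lie_isomorphicI_inv[OF linear_pairs_map bij_pairs_map[OF P dim]])
  let ?g = "pairs_map h1 h2 v1 v2 (br h1 h2) (br v1 v2)"
  let ?w = "br h1 h2" and ?w' = "br v1 v2"
  have z: "br h1 v1 = 0" "br h1 v2 = 0" "br h2 v1 = 0" "br h2 v2 = 0"
     "br h1 ?w = 0" "br h2 ?w = 0" "br v1 ?w = 0" "br v2 ?w = 0"
     "br h1 ?w' = 0" "br h2 ?w' = 0" "br v1 ?w' = 0" "br v2 ?w' = 0"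
    using P unfolding commuting_pairs_def by auto
  note z' = z[THEN br_commute_zero]
  \<comment> \<open>\<open>commuting_pairs\<close> does not ask \<open>c\<close> and
    \<open>d\<close> to commute; here this follows since \<open>?w\<close> commutes with
    \<open>v1\<close> and \<open>v2\<close>.\<close>
  have ww: "br ?w ?w' = 0" "br ?w' ?w = 0"
    using br_commute_br z' br_commute_zero by blast+
  show "?g (direct_sum_br heis_br heis_br p q) = br (?g p) (?g q)" for p q
    by (cases p; cases q; cases "fst p" rule: prod_cases3; cases "snd p" rule: prod_cases3;
        cases "fst q" rule: prod_cases3; cases "snd q" rule: prod_cases3)
      (simp add: pairs_map_def direct_sum_br_def heis_br_def br_simps z z' ww
        br_anticomm[of h2 h1] br_anticomm[of v2 v1] algebra_simps)
qed

lemma lie_isomorphic_line_heis: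
  assumes P: "commuting_pairs h1 h2 v1 v2 c (br h1 h2)" and eq: "br v1 v2 = br h1 h2"
    and dim: "dim (UNIV :: 'a set) = 6"
  shows "lie_isomorphic br (direct_sum_br line_br (heis_br :: 2 heis \<Rightarrow> 2 heis \<Rightarrow> 2 heis))"
proof -
  \<comment> \<open>The two pairs share the central vector \<open>br h1 h2\<close>, and
    \<open>c\<close> spans the line. The summands are ordered to match
    \<open>commuting_pairs_independent\<close>.\<close>
  define g :: "real \<times> 2 heis \<Rightarrow> 'a" where
    "g = (\<lambda>(s, a, b, r). (a $ 1) *\<^sub>R h1 + (b $ 1) *\<^sub>R h2 + s *\<^sub>R c
       + ((a $ 2) *\<^sub>R v1 + (b $ 2) *\<^sub>R v2 + r *\<^sub>R br h1 h2))"
  let ?w = "br h1 h2"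
  have lin: "linear g"
    by (rule linearI) (auto simp: g_def algebra_simps)
  have "p = 0" if "g p = 0" for p
    using commuting_pairs_independent[OF P] that
    by (auto simp: g_def vec_eq_iff forall_2 zero_prod_def split: prod.splits)
  then have inj: "inj g"
    using linear_injective_0[OF lin] by blast
  then have "surj g"
    by (rule linear_inj_imp_surj_dim_eq[OF lin]) (simp add: dim)
  with inj have bij: "bij g"
    by (simp add: bij_def)
  have z: "br h1 v1 = 0" "br h1 v2 = 0" "br h2 v1 = 0" "br h2 v2 = 0"
     "br h1 ?w = 0" "br h2 ?w = 0" "br v1 ?w = 0" "br v2 ?w = 0"
     "br h1 c = 0" "br h2 c = 0" "br v1 c = 0" "br v2 c = 0"
    using P unfolding commuting_pairs_def by auto
  note z' = z[THEN br_commute_zero]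
  have wc: "br c ?w = 0" "br ?w c = 0"
    using br_commute_br z' br_commute_zero by blast+
  have "g (direct_sum_br line_br heis_br p q) = br (g p) (g q)" for p q
    by (cases p rule: prod_cases4; cases q rule: prod_cases4)
      (simp add: g_def direct_sum_br_def line_br_def heis_br_def br_simps z z' wc eq sum_2
        br_anticomm[of h2 h1] br_anticomm[of v2 v1] algebra_simps)
  then show ?thesis
    by (rule lie_isomorphicI_inv[OF lin bij])
qed

lemma commuting_pairs_swap:
  "commuting_pairs h1 h2 v1 v2 c d \<Longrightarrow> commuting_pairs v1 v2 h1 h2 c d"
  unfolding commuting_pairs_def using br_commute_zero by auto

lemma commuting_pairs_change_center:
  assumes "commuting_pairs h1 h2 v1 v2 c d"
    and "c' = p *\<^sub>R c + q *\<^sub>R d" "d' = r *\<^sub>R c + s *\<^sub>R d" "p * s - q * r \<noteq> 0"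
  shows "commuting_pairs h1 h2 v1 v2 c' d'"
proof -
  have "a = 0 \<and> b = 0" if "a *\<^sub>R c' + b *\<^sub>R d' = 0" for a b
  proof -
    have "(a * p + b * r) *\<^sub>R c + (a * q + b * s) *\<^sub>R d = 0"
      using that assms(2,3) by (simp add: algebra_simps)
    then have e: "a * p + b * r = 0" "a * q + b * s = 0"
      using assms(1) unfolding commuting_pairs_def by blast+
    \<comment> \<open>Cramer's rule: each combination eliminates one of the two unknowns
      \<open>a\<close>, \<open>b\<close>.\<close>
    have "a * (p * s - q * r) = (a * p + b * r) * s - (a * q + b * s) * r"
         "b * (p * s - q * r) = (a * q + b * s) * p - (a * p + b * r) * q"
      by (simp_all add: algebra_simps)
    then have "a * (p * s - q * r) = 0" "b * (p * s - q * r) = 0"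
      unfolding e by simp_all
    then show ?thesis
      using assms(4) by simp
  qed
  then show ?thesis
    using assms(1-3) unfolding commuting_pairs_def by (simp add: br_simps)
qed

end

theorem corollary1:
  fixes br :: "'a::real_vector \<Rightarrow> 'a \<Rightarrow> 'a" and H V :: "'a set"
  assumes "lie_algebra br"
    and "dim (UNIV :: 'a set) = 6"
    and "nilpotent_lie br"
    and "mutually_respectful_decomposition br H V"
    and "open_decomposition br H V"
  shows "lie_isomorphic br (direct_sum_br (heis_br :: 1 heis \<Rightarrow> 1 heis \<Rightarrow> 1 heis)
             (heis_br :: 1 heis \<Rightarrow> 1 heis \<Rightarrow> 1 heis))
       \<or> lie_isomorphic br (direct_sum_br line_br (heis_br :: 2 heis \<Rightarrow> 2 heis \<Rightarrow> 2 heis))"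
proof -
  interpret lie_algebra br by fact
  note dim = assms(2) and nil = assms(3)
  have sub: "subspace H" "subspace V" and int: "H \<inter> V = {0}"
    and sum: "{h + v | h v. h \<in> H \<and> v \<in> V} = UNIV"
    and VH: "lie_respects br V H" and HV: "lie_respects br H V"
    using assms(4)
    by (auto simp: mutually_respectful_decomposition_def respectful_decomposition_def
        complementary_def)
  have comm: "br h v = 0" "br v h = 0" if "h \<in> H" "v \<in> V" for h v
  proof -
    have "br v h \<in> H" "br h v \<in> V"
      using lie_respectsD VH HV that by metis+
    then have "br h v \<in> H \<inter> V"
      using br_anticomm[of h v] subspace_neg[OF sub(1)] by auto
    then show "br h v = 0"
      using int by blast
    then show "br v h = 0"
      by (rule br_commute_zero)
  qed
  obtain h1 h2 where h: "h1 \<in> H" "h2 \<in> H" "br h1 h2 \<notin> H"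
    using assms(5) not_lie_subalgebraE sub(1) unfolding open_decomposition_def by metis
  obtain v1 v2 where v: "v1 \<in> V" "v2 \<in> V" "br v1 v2 \<notin> V"
    using assms(5) not_lie_subalgebraE sub(2) unfolding open_decomposition_def by metis
  obtain a d where ad: "br h1 h2 = a + d" "a \<in> H" "d \<in> V"
    using sum by blast
  obtain c b where cb: "br v1 v2 = c + b" "c \<in> H" "b \<in> V"
    using sum by blast
  have nz: "c \<noteq> 0" "d \<noteq> 0"
    using h(3) v(3) ad cb by auto
  \<comment> \<open>Since \<open>v\<close> commutes with \<open>a + d\<close> and with
    \<open>a\<close> in \<open>H\<close>, it commutes with \<open>d\<close>. The argument for
    \<open>c\<close> is symmetric.\<close>
  have "br v d = 0" if "v \<in> V" for v
  proof -
    have "br v (a + d) = 0"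
      using br_commute_br[of v h1 h2] comm h that ad(1) by simp
    then show ?thesis
      using comm(2)[OF ad(2) that] by (simp add: br_simps)
  qed
  moreover have "br h c = 0" if "h \<in> H" for h
  proof -
    have "br h (c + b) = 0"
      using br_commute_br[of h v1 v2] comm v that cb(1) by simp
    then show ?thesis
      using comm(1)[OF that cb(3)] by (simp add: br_simps)
  qed
  moreover have cd: "s = 0 \<and> t = 0" if "s *\<^sub>R c + t *\<^sub>R d = 0" for s t
  proof -
    have "s *\<^sub>R c = (- t) *\<^sub>R d"
      using that by (simp add: eq_neg_iff_add_eq_0)
    then have "s *\<^sub>R c \<in> H \<inter> V"
      using subspace_scale[OF sub(1) cb(2)] subspace_scale[OF sub(2) ad(3)] by (metis IntI)
    then have "s *\<^sub>R c = 0"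
      using int by blast
    then show ?thesis
      using that nz by simp
  qed
  \<comment> \<open>That \<open>d\<close> commutes with \<open>H\<close> and \<open>c\<close> with
    \<open>V\<close> is an instance of \<open>comm\<close>.\<close>
  ultimately have P: "commuting_pairs h1 h2 v1 v2 c d"
    unfolding commuting_pairs_def
    using comm h v ad cb subspace_0[OF sub(1)] subspace_0[OF sub(2)] by auto
  obtain p q where w: "br h1 h2 = p *\<^sub>R c + q *\<^sub>R d"
    using br_in_center_span[OF P dim nil] .
  obtain r s where w': "br v1 v2 = r *\<^sub>R c + s *\<^sub>R d"
    using br_in_center_span[OF commuting_pairs_swap[OF P] dim nil] .
  \<comment> \<open>With \<open>q = 0\<close> the bracket would be a multiple of \<open>c\<close>
    and lie in \<open>H\<close>; likewise for \<open>r\<close> and \<open>V\<close> below.\<close>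
  have q: "q \<noteq> 0"
    using h(3) w subspace_scale[OF sub(1) cb(2)] by auto
  have r: "r \<noteq> 0"
    using v(3) w' subspace_scale[OF sub(2) ad(3)] by auto
  show ?thesis
  \<comment> \<open>This determinant decides whether the two brackets are independent in the plane
    of \<open>c\<close> and \<open>d\<close>.\<close>
  proof (cases "p * s - q * r = 0")
    case False
    then show ?thesis
      using lie_isomorphic_heis_heis commuting_pairs_change_center[OF P w w'] dim by blast
  next
    case True
    then have s: "s \<noteq> 0"
      using q r by auto
    have "r = s / q * p"
      using True q by (simp add: field_simps)
    then have "br v1 v2 = (s / q) *\<^sub>R br h1 h2"
      using q by (simp add: w w' algebra_simps)
    \<comment> \<open>Rescaling \<open>v2\<close> makes the two proportional brackets equal.\<close>
    then have eq: "br v1 ((q / s) *\<^sub>R v2) = br h1 h2"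
      using q s by (simp add: br_simps)
    have "commuting_pairs h1 h2 v1 v2 c (br h1 h2)"
      \<comment> \<open>Keeping \<open>c\<close> and replacing \<open>d\<close> by
        \<open>br h1 h2\<close> has determinant \<open>q\<close>.\<close>
      using commuting_pairs_change_center[OF P _ w, of c 1 0] q by simp
    then have "commuting_pairs h1 h2 v1 ((q / s) *\<^sub>R v2) c (br h1 h2)"
      using q s unfolding commuting_pairs_def by (auto simp: br_simps)
    then show ?thesis
      using lie_isomorphic_line_heis eq dim by blast
  qed
qed

end
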